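(* Let $x$ and $y$ be indeterminates, let $K=\mathbb{Q}(x,y)$, and let $F_n(x,y)$, $n\ge0$, be the Savage-Viswanathan polynomials. Let $M$ be the exponential Riordan array $$M=\left[\frac{1}{(1+xz)(1+z)^y},\ \frac{1}{1-x}\ln\left(\frac{1+z}{1+xz}\right)\right]$$ over $K$. Then $M$ is the coefficient array of a family of orthogonal polynomials over $K$ whose moments are the polynomials $(F_{n+1}(x,y)/y)_{n\ge 0}$. Moreover, the inverse matrix of $M$ is the exponential Riordan array $$M^{-1}=\left[e^{z(x+y)}\left(\frac{1-x}{e^{xz}-xe^{z}}\right)^{y+1},\ \frac{e^{z}-e^{xz}}{e^{xz}-xe^{z}}\right],$$ and these polynomials appear as its initial column, i.e. $(M^{-1})_{n,0}=F_{n+1}(x,y)/y$ for all $n\ge 0$.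
   Context: The Savage-Viswanathan polynomials $F_n(x,y)$ are defined by the exponential generating function $\sum_{n\ge 0}F_n(x,y)\frac{z^n}{n!}=\left(\frac{1-x}{e^{z(x-1)}-x}\right)^y$ (a formal power series in $z$; the base has constant term $1$). They are polynomials in $x,y$, and $F_n$ is divisible by $y$ for $n\ge 1$. All series are formal power series in $z$; for a series $u$ with constant term $1$, $u^{c}=\exp(c\ln u)$. For formal power series $g(z)$ with $g(0)\ne 0$ and $f(z)=f_1z+f_2z^2+\cdots$ with $f_1\neq 0$, the exponential Riordan array $[g,f]$ is the infinite lower-triangular matrix $(a_{n,j})_{n,j\ge 0}$ whose $j$-th column has exponential generating function $g(z)f(z)^j/j!$, i.e. $a_{n,j}=n!\,[z^n]\,g(z)f(z)^j/j!$. A lower-triangular matrix $(a_{n,j})$ is the coefficient array of the polynomials $p_n(z)=\sum_{j=0}^n a_{n,j}z^j$. A sequence of monic polynomials $(p_n)_{n\ge0}$ over a field $K$ with $\deg p_n=n$ is (formally) orthogonal with moments $(\mu_n)_{n\ge 0}$ if the $K$-linear functional $\mathcal{L}$ on $K[z]$ with $\mathcal{L}(z^n)=\mu_n$ satisfies $\mathcal{L}(p_mp_n)=0$ for $m\neq n$ and $\mathcal{L}(p_n^2)\ne 0$ for all $n$. *)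

theory Defs
  imports "HOL-Computational_Algebra.Computational_Algebra"
begin

section \<open>The field of rational functions in two indeterminates\<close>

text \<open>
  The field \<open>K = Q(x, y)\<close> is the fraction field of \<open>Q[x][y]\<close>: the inner \<^type>\<open>poly\<close> has the
  indeterminate \<open>x\<close>, the outer one the indeterminate \<open>y\<close>.  Thus the range of \<^const>\<open>to_fract\<close> at
  this type is the ring of polynomials in \<open>x\<close> and \<open>y\<close>.
\<close>

type_synonym ratfun = "rat poly poly fract"

definition indet_x :: ratfun where
  "indet_x = to_fract [:[:0, 1:]:]"

definition indet_y :: ratfun where
  "indet_y = to_fract [:0, 1:]"


section \<open>Logarithms and powers of power series with constant term 1\<close>

text \<open>
  \<^term>\<open>fps_ln 1\<close> is the series of \<open>ln (1 + z)\<close>.  Both definitions are only meaningful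
  when the constant term of \<open>u\<close> is 1, as the inner series of \<^const>\<open>fps_compose\<close> must have constant
  term 0.
\<close>

definition fps_log :: "'a::field_char_0 fps \<Rightarrow> 'a fps" where
  "fps_log u = fps_ln 1 oo (u - 1)"

definition fps_powr :: "'a::field_char_0 fps \<Rightarrow> 'a \<Rightarrow> 'a fps" where
  "fps_powr u c = fps_exp 1 oo (fps_const c * fps_log u)"


section \<open>Savage-Viswanathan polynomials\<close>

definition sv_base :: "ratfun fps" where
  "sv_base = fps_const (1 - indet_x) / (fps_exp (indet_x - 1) - fps_const indet_x)"

text \<open>
  The polynomials are introduced as elements of the field; that they are polynomials, and divisible
  by \<open>y\<close> for positive index, is proved below.
\<close>

definition savage_viswanathan :: "nat \<Rightarrow> ratfun" where
  "savage_viswanathan n = fact n * fps_nth (fps_powr sv_base indet_y) n"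


section \<open>Infinite lower-triangular matrices and exponential Riordan arrays\<close>

definition lower_triangular :: "(nat \<Rightarrow> nat \<Rightarrow> 'a::zero) \<Rightarrow> bool" where
  "lower_triangular A \<longleftrightarrow> (\<forall>n j. n < j \<longrightarrow> A n j = 0)"

text \<open>
  For a lower-triangular \<open>A\<close>, the terms with \<open>k > n\<close> of the sum defining the matrix product vanish.
\<close>

definition lt_mult ::
    "(nat \<Rightarrow> nat \<Rightarrow> 'a::comm_ring_1) \<Rightarrow> (nat \<Rightarrow> nat \<Rightarrow> 'a) \<Rightarrow> nat \<Rightarrow> nat \<Rightarrow> 'a" where
  "lt_mult A B n j = (\<Sum>k\<le>n. A n k * B k j)"

definition lt_inverse :: "(nat \<Rightarrow> nat \<Rightarrow> 'a::comm_ring_1) \<Rightarrow> (nat \<Rightarrow> nat \<Rightarrow> 'a) \<Rightarrow> bool" where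
  "lt_inverse A B \<longleftrightarrow> lower_triangular A \<and> lower_triangular B \<and>
     (\<forall>n j. lt_mult A B n j = (if n = j then 1 else 0)) \<and>
     (\<forall>n j. lt_mult B A n j = (if n = j then 1 else 0))"

definition exp_riordan_pair :: "'a::field_char_0 fps \<Rightarrow> 'a fps \<Rightarrow> bool" where
  "exp_riordan_pair g f \<longleftrightarrow> fps_nth g 0 \<noteq> 0 \<and> fps_nth f 0 = 0 \<and> fps_nth f 1 \<noteq> 0"

definition exp_riordan :: "'a::field_char_0 fps \<Rightarrow> 'a fps \<Rightarrow> nat \<Rightarrow> nat \<Rightarrow> 'a" where
  "exp_riordan g f n j = fact n * fps_nth (g * f ^ j * fps_const (1 / fact j)) n"


section \<open>Coefficient arrays and formal orthogonality\<close>

definition coefficient_array ::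
    "(nat \<Rightarrow> nat \<Rightarrow> 'a::comm_ring_1) \<Rightarrow> (nat \<Rightarrow> 'a poly) \<Rightarrow> bool" where
  "coefficient_array A p \<longleftrightarrow>
     lower_triangular A \<and> (\<forall>n. p n = (\<Sum>j\<le>n. monom (A n j) j))"

text \<open>The linear functional on polynomials that maps the \<open>n\<close>-th power of the indeterminate to \<open>\<mu> n\<close>.\<close>

definition moment_functional :: "(nat \<Rightarrow> 'a) \<Rightarrow> 'a::field poly \<Rightarrow> 'a" where
  "moment_functional \<mu> p = (\<Sum>i\<le>degree p. coeff p i * \<mu> i)"

definition orthogonal_with_moments :: "(nat \<Rightarrow> 'a::field poly) \<Rightarrow> (nat \<Rightarrow> 'a) \<Rightarrow> bool" where
  "orthogonal_with_moments p \<mu> \<longleftrightarrow>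
     (\<forall>n. degree (p n) = n \<and> lead_coeff (p n) = 1) \<and>
     (\<forall>m n. m \<noteq> n \<longrightarrow> moment_functional \<mu> (p m * p n) = 0) \<and>
     (\<forall>n. moment_functional \<mu> (p n ^ 2) \<noteq> 0)"


section \<open>Basic facts about the definitions\<close>

lemma moment_functional_eq_sum:
  assumes "degree p \<le> N"
  shows "moment_functional \<mu> p = (\<Sum>i\<le>N. coeff p i * \<mu> i)"
  unfolding moment_functional_def
  by (rule sum.mono_neutral_left) (use assms in \<open>auto simp: coeff_eq_0\<close>)

lemma moment_functional_add:
  "moment_functional \<mu> (p + q) = moment_functional \<mu> p + moment_functional \<mu> q"
proof -
  let ?N = "max (degree p) (degree q)"
  have "degree (p + q) \<le> ?N" by (rule degree_add_le) auto
  thus ?thesis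
    by (simp add: moment_functional_eq_sum[of _ ?N] sum.distrib algebra_simps)
qed

lemma moment_functional_smult: "moment_functional \<mu> (smult c p) = c * moment_functional \<mu> p"
  by (simp add: moment_functional_eq_sum[OF degree_smult_le] moment_functional_def[of _ p]
      sum_distrib_left mult.assoc)

lemma moment_functional_monom: "moment_functional \<mu> (monom 1 n) = \<mu> n"
  by (simp add: moment_functional_def degree_monom_eq if_distrib[of "\<lambda>a. a * _"] cong: if_cong)

lemma lower_triangular_exp_riordan:
  assumes "exp_riordan_pair g f"
  shows "lower_triangular (exp_riordan g f)"
proof -
  have "fps_nth (g * f ^ j) n = 0" if "n < j" for n j
  proof -
    have "fps_nth (f ^ j) i = 0" if "i < j" for i
      using assms that by (auto simp: exp_riordan_pair_def intro: startsby_zero_power_prefix[rule_format])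
    thus ?thesis using that by (simp add: fps_mult_nth)
  qed
  thus ?thesis by (simp add: lower_triangular_def exp_riordan_def)
qed

lemma fps_log_nth_0 [simp]: "fps_nth (fps_log u) 0 = 0"
  by (simp add: fps_log_def)

lemma fps_powr_nth_0 [simp]: "fps_nth (fps_powr u c) 0 = 1"
  by (simp add: fps_powr_def)

lemma indet_x_neq_1: "indet_x \<noteq> 1"
proof
  assume "indet_x = 1"
  hence "to_fract [:[:0, 1:]:] = to_fract (1 :: rat poly poly)" by (simp add: indet_x_def)
  thus False by (simp only: to_fract_eq_iff) (simp add: one_pCons)
qed

lemma indet_y_neq_0: "indet_y \<noteq> 0"
  by (simp add: indet_y_def)

lemma sv_base_mult:
  "sv_base * (fps_exp (indet_x - 1) - fps_const indet_x) = fps_const (1 - indet_x)"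
  using indet_x_neq_1 by (simp add: sv_base_def fps_divide_unit mult.assoc inverse_mult_eq_1)

lemma sv_base_nth_0: "fps_nth sv_base 0 = 1"
  using indet_x_neq_1 arg_cong[OF sv_base_mult, of "\<lambda>u. fps_nth u 0"] by simp

lemma fps_divide_nth_1:
  fixes a b :: "'a::field fps"
  assumes "fps_nth b 0 \<noteq> 0"
  shows "fps_nth (a / b) 1 =
    (fps_nth a 1 * fps_nth b 0 - fps_nth a 0 * fps_nth b 1) / fps_nth b 0 ^ 2"
proof -
  define q where "q = a / b"
  have "a = q * b"
    using assms by (simp add: q_def fps_divide_unit mult.assoc inverse_mult_eq_1)
  hence "fps_nth a 0 = fps_nth q 0 * fps_nth b 0"
    and "fps_nth a 1 = fps_nth q 0 * fps_nth b 1 + fps_nth q 1 * fps_nth b 0"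
    by (simp_all add: fps_mult_nth_1)
  thus ?thesis unfolding q_def[symmetric]
    using assms by (simp add: field_simps power2_eq_square)
qed

lemma exp_riordan_pair_array:
  "exp_riordan_pair
     (1 / ((1 + fps_const indet_x * fps_X) * fps_powr (1 + fps_X) indet_y))
     (fps_const (1 / (1 - indet_x)) * fps_log ((1 + fps_X) / (1 + fps_const indet_x * fps_X)))"
proof -
  let ?u = "(1 + fps_X) / (1 + fps_const indet_x * fps_X)"
  have "fps_nth (fps_log ?u) 1 = fps_nth ?u 1"
    by (simp add: fps_log_def fps_compose_nth fps_ln_nth)
  also have "\<dots> = 1 - indet_x"
    by (subst fps_divide_nth_1) simp_all
  finally show ?thesis
    using indet_x_neq_1 by (simp add: exp_riordan_pair_def fps_divide_unit)
qed

lemma exp_riordan_pair_inverse_array: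
  "exp_riordan_pair
     (fps_exp (indet_x + indet_y) *
        fps_powr (fps_const (1 - indet_x) / (fps_exp indet_x - fps_const indet_x * fps_exp 1))
          (indet_y + 1))
     ((fps_exp 1 - fps_exp indet_x) / (fps_exp indet_x - fps_const indet_x * fps_exp 1))"
  using indet_x_neq_1
  by (simp add: exp_riordan_pair_def fps_divide_nth_1[unfolded One_nat_def] fps_divide_unit)

lemma inverse_array_base_nth_0:
  "fps_nth (fps_const (1 - indet_x) / (fps_exp indet_x - fps_const indet_x * fps_exp 1)) 0 = 1"
  using indet_x_neq_1 by (simp add: fps_divide_unit)


section \<open>Polynomiality of the Savage-Viswanathan polynomials\<close>

lemma fps_deriv_log:
  assumes "fps_nth u 0 = 1"
  shows "fps_deriv (fps_log u) * u = fps_deriv u"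
proof -
  have "inverse (1 + fps_X) oo (u - 1) = inverse u"
    using assms by (subst fps_inverse_compose) (simp_all add: fps_compose_add_distrib)
  thus ?thesis
    using assms
    by (simp add: fps_log_def fps_compose_deriv fps_ln_deriv mult.assoc mult.commute[of "fps_deriv u"]
        inverse_mult_eq_1 flip: mult.assoc)
qed

lemma fps_deriv_powr:
  "fps_deriv (fps_powr u c) = fps_const c * fps_powr u c * fps_deriv (fps_log u)"
  by (simp add: fps_powr_def fps_compose_deriv mult_ac)

definition polys_upto :: "nat \<Rightarrow> ratfun fps \<Rightarrow> bool" where
  "polys_upto n f \<longleftrightarrow> (\<forall>k\<le>n. fact k * fps_nth f k \<in> range to_fract)"

lemma range_to_fract_add: "a \<in> range to_fract \<Longrightarrow> b \<in> range to_fract \<Longrightarrow> a + b \<in> range to_fract"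
  by (elim rangeE) (simp flip: to_fract_add)

lemma range_to_fract_diff: "a \<in> range to_fract \<Longrightarrow> b \<in> range to_fract \<Longrightarrow> a - b \<in> range to_fract"
  by (elim rangeE) (simp flip: to_fract_diff)

lemma range_to_fract_mult: "a \<in> range to_fract \<Longrightarrow> b \<in> range to_fract \<Longrightarrow> a * b \<in> range to_fract"
  by (elim rangeE) (simp flip: to_fract_mult)

lemma range_to_fract_sum: "(\<And>i. i \<in> A \<Longrightarrow> h i \<in> range to_fract) \<Longrightarrow> sum h A \<in> range to_fract"
  by (induction A rule: infinite_finite_induct)
     (auto intro: range_to_fract_add range_eqI[of _ _ 0] simp del: image_iff)

lemma range_to_fract_of_nat: "of_nat k \<in> range (to_fract :: rat poly poly \<Rightarrow> ratfun)"
  by (metis of_nat_fract rangeI to_fract_def)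

lemma range_to_fract_1: "1 \<in> range (to_fract :: rat poly poly \<Rightarrow> ratfun)"
  using range_to_fract_of_nat[of 1] by simp

lemma range_to_fract_x: "indet_x \<in> range to_fract"
  by (simp add: indet_x_def)

lemma range_to_fract_y: "indet_y \<in> range to_fract"
  by (simp add: indet_y_def)

lemma polys_upto_add: "polys_upto n f \<Longrightarrow> polys_upto n g \<Longrightarrow> polys_upto n (f + g)"
  by (simp add: polys_upto_def distrib_left range_to_fract_add)

lemma polys_upto_const_mult: "c \<in> range to_fract \<Longrightarrow> polys_upto n f \<Longrightarrow> polys_upto n (fps_const c * f)"
  unfolding polys_upto_def by (simp add: mult.left_commute range_to_fract_mult)

lemma polys_upto_mult:
  assumes "polys_upto n f" "polys_upto n g"
  shows "polys_upto n (f * g)"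
  unfolding polys_upto_def
proof (intro allI impI)
  fix k assume k: "k \<le> n"
  have "fact k * fps_nth (f * g) k =
      (\<Sum>i=0..k. of_nat (k choose i) * ((fact i * fps_nth f i) * (fact (k - i) * fps_nth g (k - i))))"
    unfolding fps_mult_nth sum_distrib_left
    by (intro sum.cong refl) (simp add: binomial_fact)
  also have "\<dots> \<in> range to_fract"
    using assms k
  proof (intro range_to_fract_sum range_to_fract_mult[OF range_to_fract_of_nat])
    fix i assume "i \<in> {0..k}"
    hence "fact i * fps_nth f i \<in> range to_fract"
      and "fact (k - i) * fps_nth g (k - i) \<in> range to_fract"
      using assms k by (auto simp: polys_upto_def)
    thus "(fact i * fps_nth f i) * (fact (k - i) * fps_nth g (k - i)) \<in> range to_fract"
      by (rule range_to_fract_mult)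
  qed
  finally show "fact k * fps_nth (f * g) k \<in> range to_fract" .
qed

lemma polys_upto_deriv:
  assumes "fps_nth f 0 \<in> range to_fract" "polys_upto n (fps_deriv f)"
  shows "polys_upto (Suc n) f"
  unfolding polys_upto_def
proof (intro allI impI)
  fix k assume k: "k \<le> Suc n"
  show "fact k * fps_nth f k \<in> range to_fract"
  proof (cases k)
    case 0
    thus ?thesis using assms(1) by simp
  next
    case (Suc j)
    hence "fact j * fps_nth (fps_deriv f) j \<in> range to_fract"
      using assms(2) k by (simp add: polys_upto_def)
    thus ?thesis by (simp add: Suc mult_ac)
  qed
qed

lemma sv_base_deriv:
  "fps_deriv sv_base = (fps_const (1 - indet_x) + fps_const indet_x * sv_base) * sv_base"
proof -
  define E where "E = fps_exp (indet_x - 1)"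
  define d where "d = E - fps_const indet_x"
  have d0: "d \<noteq> 0"
    using indet_x_neq_1 by (auto simp: d_def E_def dest!: arg_cong[of _ _ "\<lambda>u. fps_nth u 0"])
  have m: "sv_base * d = fps_const (1 - indet_x)"
    using sv_base_mult by (simp add: d_def E_def)
  have dd: "fps_deriv d = - (fps_const (1 - indet_x) * (d + fps_const indet_x))"
    by (simp add: d_def E_def fps_const_neg[symmetric] algebra_simps del: fps_const_neg
        fps_const_sub flip: fps_const_sub)
  have "fps_deriv (sv_base * d) = 0"
    by (simp add: m)
  hence "fps_deriv sv_base * d = - (sv_base * fps_deriv d)"
    by (simp only: fps_deriv_mult) (simp only: eq_neg_iff_add_eq_0 add.commute)
  hence "fps_deriv sv_base * d = sv_base * (fps_const (1 - indet_x) * (d + fps_const indet_x))"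
    by (simp only: dd mult_minus_right minus_minus)
  also have "\<dots> = (fps_const (1 - indet_x) + fps_const indet_x * sv_base) * sv_base * d"
    unfolding m[symmetric] by (simp add: algebra_simps)
  finally show ?thesis using d0 by simp
qed

lemma polys_upto_sv_base: "polys_upto n sv_base"
proof (induction n)
  case 0
  show ?case using range_to_fract_1 by (simp add: polys_upto_def sv_base_nth_0)
next
  case (Suc n)
  have "polys_upto n (fps_const (1 - indet_x) * sv_base + fps_const indet_x * (sv_base * sv_base))"
    by (intro polys_upto_add polys_upto_const_mult polys_upto_mult Suc range_to_fract_diff
        range_to_fract_1 range_to_fract_x)
  hence "polys_upto n (fps_deriv sv_base)"
    by (simp add: sv_base_deriv algebra_simps)
  thus ?case
    using range_to_fract_1 by (intro polys_upto_deriv) (simp_all add: sv_base_nth_0)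
qed

lemma sv_deriv:
  "fps_deriv (fps_powr sv_base indet_y) = fps_const indet_y *
     (fps_const (1 - indet_x) * fps_powr sv_base indet_y +
      fps_const indet_x * (sv_base * fps_powr sv_base indet_y))"
proof -
  have "sv_base \<noteq> 0" using sv_base_nth_0 by auto
  moreover have "fps_deriv (fps_log sv_base) * sv_base =
      (fps_const (1 - indet_x) + fps_const indet_x * sv_base) * sv_base"
    by (simp only: fps_deriv_log[OF sv_base_nth_0] sv_base_deriv)
  ultimately have "fps_deriv (fps_log sv_base) = fps_const (1 - indet_x) + fps_const indet_x * sv_base"
    by simp
  thus ?thesis by (simp add: fps_deriv_powr algebra_simps)
qed

lemma polys_upto_sv_step:
  assumes "polys_upto n (fps_powr sv_base indet_y)"
  shows "polys_upto n (fps_const (1 - indet_x) * fps_powr sv_base indet_y +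
      fps_const indet_x * (sv_base * fps_powr sv_base indet_y))"
  by (intro polys_upto_add polys_upto_const_mult polys_upto_mult polys_upto_sv_base
      range_to_fract_diff range_to_fract_1 range_to_fract_x assms)

lemma polys_upto_sv: "polys_upto n (fps_powr sv_base indet_y)"
proof (induction n)
  case 0
  show ?case using range_to_fract_1 by (simp add: polys_upto_def)
next
  case (Suc n)
  show ?case
    using range_to_fract_1
    by (intro polys_upto_deriv)
       (simp_all only: fps_powr_nth_0 sv_deriv
         polys_upto_const_mult[OF range_to_fract_y polys_upto_sv_step[OF Suc]])
qed

theorem savage_viswanathan_polynomial: "savage_viswanathan n \<in> range to_fract"
  using polys_upto_sv[of n] by (simp add: polys_upto_def savage_viswanathan_def)

theorem savage_viswanathan_divisible: "savage_viswanathan (Suc n) / indet_y \<in> range to_fract"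
proof -
  define h where "h = fps_const (1 - indet_x) * fps_powr sv_base indet_y +
      fps_const indet_x * (sv_base * fps_powr sv_base indet_y)"
  have "savage_viswanathan (Suc n) = fact n * fps_nth (fps_deriv (fps_powr sv_base indet_y)) n"
    by (simp add: savage_viswanathan_def mult_ac)
  also have "\<dots> = indet_y * (fact n * fps_nth h n)"
    unfolding sv_deriv h_def[symmetric] by (simp only: fps_mult_left_const_nth mult.left_commute)
  finally have "savage_viswanathan (Suc n) / indet_y = fact n * fps_nth h n"
    using indet_y_neq_0 by simp
  thus ?thesis
    using polys_upto_sv_step[OF polys_upto_sv, of n] by (simp add: polys_upto_def h_def)
qed

end

theory Submission
  imports Defs
begin

text \<open>
  Put \<open>R = (1 + x u) (1 + u)\<close> and \<open>S = (1 + x u) (1 + u)^y\<close>, where \<open>u\<close> is the variable of the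
  series.  The array \<open>M\<close> is \<open>[1 / S, f]\<close>, and the compositional inverse of \<open>f\<close> is \<open>\<phi> = B - 1\<close>, where
  \<open>B\<close> is the base of the Savage-Viswanathan series.  It satisfies \<open>\<phi>' = R(\<phi>)\<close>, and the exponential
  generating function of the moments is \<open>G = S(\<phi>)\<close>; so \<open>[G, \<phi>]\<close> is inverse to \<open>M\<close>.

  By the fundamental theorem of Riordan arrays, the functional takes the value \<open>n! [u^n] Q\<^sub>k\<close> at
  \<open>z^k p\<^sub>n\<close>, where \<open>G^(k) = (S Q\<^sub>k)(\<phi>)\<close>.  Here \<open>Q\<^sub>0 = 1\<close> and
  \<open>Q\<^sub>k\<^sub>+\<^sub>1 = R Q\<^sub>k' + (x (1 + u) + y (1 + x u)) Q\<^sub>k\<close>, so \<open>Q\<^sub>k\<close> is a polynomial of degree \<open>k\<close> with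
  leading coefficient \<open>x^k (y + 1) \<dots> (y + k) \<noteq> 0\<close>.  This gives orthogonality directly.
\<close>

section \<open>Logarithms and powers of power series\<close>

text \<open>Uniqueness for a linear first-order equation: \<open>f * inverse g\<close> has
  derivative zero, so it is a constant, here 1.\<close>

lemma fps_eqI_log_deriv:
  fixes f g a :: "'a::field_char_0 fps"
  assumes f: "fps_deriv f = f * a" and g: "fps_deriv g = g * a"
    and "fps_nth f 0 = fps_nth g 0" and g0: "fps_nth g 0 \<noteq> 0"
  shows "f = g"
proof -
  have inv: "g * inverse g = 1"
    by (subst mult.commute) (rule inverse_mult_eq_1[OF g0])
  have "fps_deriv (f * inverse g) = f * a * inverse g - f * inverse g * a * (g * inverse g)"
    using g0 by (simp add: fps_inverse_deriv f g power2_eq_square algebra_simps)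
  hence "fps_deriv (f * inverse g) = 0"
    by (simp add: inv)
  hence "f * inverse g = fps_const (fps_nth (f * inverse g) 0)"
    unfolding fps_deriv_eq_0_iff .
  also have "\<dots> = 1"
    using assms by simp
  finally have "f * (g * inverse g) = g"
    by (simp add: mult.left_commute)
  thus ?thesis by (simp add: inv)
qed

lemma fps_deriv_log_eqI:
  assumes "fps_nth u 0 = 1" "fps_deriv u = u * a"
  shows "fps_deriv (fps_log u) = a"
proof -
  have "u \<noteq> 0" using assms(1) by auto
  moreover have "fps_deriv (fps_log u) * u = a * u"
    using fps_deriv_log[OF assms(1)] assms(2) by (simp add: mult.commute)
  ultimately show ?thesis by simp
qed

lemma fps_powr_compose:
  fixes f :: "'a::field_char_0 fps"
  assumes "fps_nth f 0 = 0"
  shows "fps_powr (1 + fps_X) c oo f = fps_powr (1 + f) c"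
  using assms
  by (simp add: fps_powr_def fps_log_def fps_compose_assoc[symmetric] fps_compose_mult_distrib)

lemma fps_deriv_powr_one_plus_X:
  "(1 + fps_X) * fps_deriv (fps_powr (1 + fps_X) c) = fps_const c * fps_powr (1 + fps_X) c"
  using fps_deriv_log[of "1 + fps_X :: 'a::field_char_0 fps"]
  by (simp add: fps_deriv_powr mult_ac)

text \<open>By associativity \<open>f\<close> agrees with \<open>fps_inv g\<close>, which is a
  two-sided inverse.\<close>

lemma fps_compose_X_swap:
  fixes f g :: "'a::field fps"
  assumes "fps_nth f 0 = 0" "fps_nth g 0 = 0" "fps_nth g 1 \<noteq> 0" "f oo g = fps_X"
  shows "g oo f = fps_X"
proof -
  have "f = f oo (g oo fps_inv g)"
    using assms by (simp add: fps_inv_right)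
  also have "\<dots> = (f oo g) oo fps_inv g"
    using assms by (simp add: fps_compose_assoc fps_inv_def)
  also have "\<dots> = fps_inv g"
    using assms by (simp add: fps_inv_def)
  finally show ?thesis using assms by (simp add: fps_inv_right)
qed

section \<open>Exponential Riordan arrays\<close>

lemma fps_nth_mult_compose:
  fixes f g h :: "'a::field fps"
  assumes "fps_nth f 0 = 0"
  shows "fps_nth (g * (h oo f)) n = (\<Sum>k\<le>n. fps_nth h k * fps_nth (g * f ^ k) n)"
proof -
  \<comment> \<open>As \<open>f ^ k\<close> starts at order \<open>k\<close> or later, one cutoff
    \<open>n\<close> serves all \<open>m \<le> n\<close>; the two sums can then be swapped.\<close>
  have "fps_nth (h oo f) m = (\<Sum>k\<le>n. fps_nth h k * fps_nth (f ^ k) m)" if "m \<le> n" for m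
    unfolding fps_compose_nth
    by (rule sum.mono_neutral_left)
      (use assms that in \<open>auto intro: startsby_zero_power_prefix[rule_format]\<close>)
  hence "fps_nth (g * (h oo f)) n =
      (\<Sum>i=0..n. \<Sum>k\<le>n. fps_nth g i * (fps_nth h k * fps_nth (f ^ k) (n - i)))"
    by (simp add: fps_mult_nth sum_distrib_left)
  also have "\<dots> = (\<Sum>k\<le>n. fps_nth h k * fps_nth (g * f ^ k) n)"
    by (subst sum.swap) (simp add: fps_mult_nth sum_distrib_left mult_ac)
  finally show ?thesis .
qed

text \<open>The fundamental theorem of Riordan arrays; \<open>fact k\<close> cancels the
  \<open>1 / fact k\<close> of column \<open>k\<close>.\<close>

lemma sum_exp_riordan:
  assumes "fps_nth f 0 = 0"
  shows "(\<Sum>k\<le>n. exp_riordan g f n k * (fact k * fps_nth h k)) = fact n * fps_nth (g * (h oo f)) n"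
  unfolding fps_nth_mult_compose[OF assms] sum_distrib_left
  by (intro sum.cong) (simp_all add: exp_riordan_def)

lemma lt_mult_exp_riordan:
  assumes "fps_nth f 0 = 0"
  shows "lt_mult (exp_riordan g f) (exp_riordan g' f') = exp_riordan (g * (g' oo f)) (f' oo f)"
proof (intro ext)
  fix n j
  have "lt_mult (exp_riordan g f) (exp_riordan g' f') n j =
      fact n * fps_nth (g * ((g' * f' ^ j * fps_const (1 / fact j)) oo f)) n"
    unfolding sum_exp_riordan[OF assms, symmetric] by (simp add: lt_mult_def exp_riordan_def)
  also have "\<dots> = exp_riordan (g * (g' oo f)) (f' oo f) n j"
    using assms
    by (simp add: exp_riordan_def fps_compose_mult_distrib fps_compose_power mult.assoc)
  finally show "lt_mult (exp_riordan g f) (exp_riordan g' f') n j = \<dots>" .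
qed

lemma exp_riordan_1_X: "exp_riordan 1 fps_X n j = (if n = j then 1 else 0)"
  by (simp add: exp_riordan_def fps_X_power_nth)

text \<open>By the product law, each order has outer series 1 and inner series \<open>fps_X\<close>:
  composing \<open>s oo \<phi>\<close> with \<open>f\<close> gives back \<open>s\<close>, and
  \<open>g * s = 1\<close> survives substitution of \<open>\<phi>\<close>.\<close>

lemma lt_inverse_exp_riordan:
  assumes "exp_riordan_pair g f" "exp_riordan_pair (s oo \<phi>) \<phi>"
    and "f oo \<phi> = fps_X" and "g * s = 1"
  shows "lt_inverse (exp_riordan g f) (exp_riordan (s oo \<phi>) \<phi>)"
proof -
  have f0: "fps_nth f 0 = 0" and \<phi>0: "fps_nth \<phi> 0 = 0" and "fps_nth \<phi> 1 \<noteq> 0"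
    using assms by (simp_all add: exp_riordan_pair_def)
  hence \<phi>f: "\<phi> oo f = fps_X"
    by (rule fps_compose_X_swap[OF _ _ _ assms(3)])
  have "g * ((s oo \<phi>) oo f) = 1"
    unfolding fps_compose_assoc[OF f0 \<phi>0, symmetric] \<phi>f by (simp add: assms)
  moreover have "(s oo \<phi>) * (g oo \<phi>) = 1"
    unfolding fps_compose_mult_distrib[OF \<phi>0, symmetric] mult.commute[of s] by (simp add: assms)
  ultimately show ?thesis
    using assms(1-3) \<phi>f
    by (simp add: lt_inverse_def lower_triangular_exp_riordan lt_mult_exp_riordan[OF f0]
        lt_mult_exp_riordan[OF \<phi>0] exp_riordan_1_X)
qed

lemma exp_riordan_diagonal:
  assumes "fps_nth f 0 = 0"
  shows "exp_riordan g f n n = fps_nth g 0 * fps_nth f 1 ^ n"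
proof -
  have "fps_nth (g * f ^ n) n = (\<Sum>i=0..n. fps_nth g i * fps_nth (f ^ n) (n - i))"
    by (rule fps_mult_nth)
  also have "\<dots> = (\<Sum>i\<in>{0}. fps_nth g i * fps_nth (f ^ n) (n - i))"
    by (rule sum.mono_neutral_right)
      (use assms in \<open>auto intro: startsby_zero_power_prefix[rule_format]\<close>)
  finally show ?thesis
    using assms by (simp add: exp_riordan_def startsby_zero_power_nth_same)
qed

section \<open>Orthogonality of coefficient arrays\<close>

definition row_poly :: "(nat \<Rightarrow> nat \<Rightarrow> 'a::comm_ring_1) \<Rightarrow> nat \<Rightarrow> 'a poly" where
  "row_poly A n = (\<Sum>j\<le>n. monom (A n j) j)"

lemma coeff_row_poly: "coeff (row_poly A n) j = (if j \<le> n then A n j else 0)"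
  by (simp add: row_poly_def coeff_sum if_distrib sum.delta cong: if_cong)

lemma degree_row_poly_le: "degree (row_poly A n) \<le> n"
  by (rule degree_le) (simp add: coeff_row_poly)

lemma moment_functional_sum:
  "moment_functional \<mu> (\<Sum>i\<in>I. q i) = (\<Sum>i\<in>I. moment_functional \<mu> (q i))"
proof (induction I rule: infinite_finite_induct)
  case (insert i I)
  thus ?case by (simp add: moment_functional_add)
qed (simp_all add: moment_functional_def)

lemma moment_functional_row_poly_mult:
  "moment_functional \<mu> (row_poly A n * q) = (\<Sum>j\<le>n. A n j * moment_functional \<mu> (monom 1 j * q))"
proof -
  have "row_poly A n * q = (\<Sum>j\<le>n. smult (A n j) (monom 1 j * q))"
    by (simp add: row_poly_def sum_distrib_right smult_monom flip: mult_smult_left)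
  thus ?thesis by (simp add: moment_functional_sum moment_functional_smult)
qed

text \<open>Expand the factor of smaller degree in monomials; each product with the other factor is
  then annihilated. In the square only the top monomial survives, with coefficient 1.\<close>

lemma orthogonal_row_polyI:
  fixes A :: "nat \<Rightarrow> nat \<Rightarrow> 'a::field"
  assumes diag: "\<And>n. A n n = 1"
    and below: "\<And>k n. k < n \<Longrightarrow> moment_functional \<mu> (monom 1 k * row_poly A n) = 0"
    and eq: "\<And>n. moment_functional \<mu> (monom 1 n * row_poly A n) \<noteq> 0"
  shows "orthogonal_with_moments (row_poly A) \<mu>"
proof -
  have deg: "degree (row_poly A n) = n" for n
  proof (rule antisym)
    show "n \<le> degree (row_poly A n)"
      by (rule le_degree) (simp add: coeff_row_poly diag)
  qed (rule degree_row_poly_le)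
  have less: "moment_functional \<mu> (row_poly A m * row_poly A n) = 0" if "m < n" for m n
    unfolding moment_functional_row_poly_mult by (intro sum.neutral) (use that below in auto)
  have "moment_functional \<mu> (row_poly A m * row_poly A n) = 0" if "m \<noteq> n" for m n
    using less[of m n] less[of n m] that by (cases "m < n") (auto simp: mult.commute)
  moreover have "moment_functional \<mu> (row_poly A n ^ 2) \<noteq> 0" for n
  proof -
    have "moment_functional \<mu> (row_poly A n ^ 2) =
        (\<Sum>j\<in>{n}. A n j * moment_functional \<mu> (monom 1 j * row_poly A n))"
      unfolding power2_eq_square moment_functional_row_poly_mult
      by (rule sum.mono_neutral_right) (auto simp: below)
    thus ?thesis using eq[of n] by (simp add: diag)
  qed
  ultimately show ?thesis
    by (simp add: orthogonal_with_moments_def deg coeff_row_poly diag)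
qed

lemma moment_functional_monom_mult_row_poly:
  "moment_functional \<mu> (monom 1 k * row_poly A n) = (\<Sum>j\<le>n. A n j * \<mu> (j + k))"
  unfolding mult.commute[of "monom 1 k"] moment_functional_row_poly_mult
  by (simp add: mult_monom moment_functional_monom)

lemma fact_mult_nth_higher_deriv:
  "fact j * fps_nth ((fps_deriv ^^ k) f) j = fact (j + k) * fps_nth (f :: 'a::field_char_0 fps) (j + k)"
proof (induction k arbitrary: j)
  case (Suc k)
  show ?case using Suc[of "Suc j"] by (simp add: mult_ac)
qed simp

text \<open>Shifting the moments by \<open>k\<close> differentiates \<open>G\<close>
  \<open>k\<close> times; the fundamental theorem then applies to that derivative.\<close>

lemma moment_functional_exp_riordan:
  assumes "fps_nth f 0 = 0" "\<And>n. \<mu> n = fact n * fps_nth G n"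
  shows "moment_functional \<mu> (monom 1 k * row_poly (exp_riordan g f) n) =
    fact n * fps_nth (g * ((fps_deriv ^^ k) G oo f)) n"
  unfolding sum_exp_riordan[OF assms(1), symmetric] moment_functional_monom_mult_row_poly
  by (simp add: assms(2) fact_mult_nth_higher_deriv)

section \<open>The Savage-Viswanathan moments\<close>

text \<open>These are the polynomials \<open>Q\<^sub>k\<close> above; below, \<open>sv_rate\<close> is \<open>R\<close> and \<open>sv_weight\<close> is \<open>S\<close>.\<close>

fun moment_poly :: "nat \<Rightarrow> ratfun poly" where
  "moment_poly 0 = 1"
| "moment_poly (Suc k) =
    [:1, 1 + indet_x, indet_x:] * pderiv (moment_poly k) +
    [:indet_x + indet_y, indet_x + indet_x * indet_y:] * moment_poly k"

lemma coeff_moment_poly_above: "k < n \<Longrightarrow> coeff (moment_poly k) n = 0"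
proof (induction k arbitrary: n)
  case (Suc k)
  \<comment> \<open>Both products read \<open>moment_poly k\<close> at indices from
    \<open>n - 1\<close> to \<open>n + 1\<close>, all above \<open>k\<close>; the double
    \<open>Suc\<close> exposes them.\<close>
  then obtain m where "n = Suc (Suc m)" by (metis Suc_lessE less_Suc_eq_0_disj not_less_eq)
  with Suc show ?case by (simp add: coeff_pderiv)
qed simp

text \<open>In top degree the derivative term contributes \<open>x k\<close> and the linear factor
  \<open>x + x y\<close>.\<close>

lemma coeff_moment_poly_Suc:
  "coeff (moment_poly (Suc k)) (Suc k) =
    indet_x * (indet_y + of_nat (Suc k)) * coeff (moment_poly k) k"
proof -
  define q where "q = moment_poly k"
  have "coeff q (Suc k) = 0" "coeff q (Suc (Suc k)) = 0"
    by (simp_all add: q_def coeff_moment_poly_above)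
  hence "coeff ([:1, 1 + indet_x, indet_x:] * pderiv q +
      [:indet_x + indet_y, indet_x + indet_x * indet_y:] * q) (Suc k) =
    indet_x * (indet_y + of_nat (Suc k)) * coeff q k"
    by (cases k) (simp_all add: coeff_pderiv algebra_simps)
  thus ?thesis by (simp add: q_def)
qed

lemma indet_x_neq_0: "indet_x \<noteq> 0"
  by (simp add: indet_x_def)

lemma indet_y_plus_of_nat_neq_0: "indet_y + of_nat k \<noteq> 0"
proof -
  have "indet_y + of_nat k = to_fract ([:0, 1:] + of_nat k)"
    by (simp add: indet_y_def of_nat_fract to_fract_def)
  moreover have "[:0, 1:] + of_nat k \<noteq> (0 :: rat poly poly)"
    by (simp add: of_nat_poly)
  ultimately show ?thesis by (simp only: to_fract_eq_0_iff) simp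
qed

lemma coeff_moment_poly_diag: "coeff (moment_poly k) k \<noteq> 0"
proof (induction k)
  case (Suc k)
  thus ?case
    using indet_x_neq_0 indet_y_plus_of_nat_neq_0[of "Suc k"]
    by (simp only: coeff_moment_poly_Suc) simp
qed simp

section \<open>The inverse array in terms of the Savage-Viswanathan base\<close>

abbreviation (input) sv_rate :: "ratfun fps" where
  "sv_rate \<equiv> (1 + fps_const indet_x * fps_X) * (1 + fps_X)"

abbreviation (input) sv_weight :: "ratfun fps" where
  "sv_weight \<equiv> (1 + fps_const indet_x * fps_X) * fps_powr (1 + fps_X) indet_y"

abbreviation (input) inverse_denom :: "ratfun fps" where
  "inverse_denom \<equiv> fps_exp indet_x - fps_const indet_x * fps_exp 1"

lemma inverse_denom_nth_0: "fps_nth inverse_denom 0 \<noteq> 0"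
  using indet_x_neq_1 by simp

text \<open>Factoring \<open>e^z\<close> out of the denominator leaves the denominator of
  \<open>sv_base\<close>.\<close>

lemma sv_base_mult_inverse_denom: "sv_base * inverse_denom = fps_const (1 - indet_x) * fps_exp 1"
proof -
  have "fps_exp indet_x = fps_exp (indet_x - 1) * fps_exp (1 :: ratfun)"
    by (simp flip: fps_exp_add_mult)
  hence "inverse_denom = (fps_exp (indet_x - 1) - fps_const indet_x) * fps_exp 1"
    by (simp add: algebra_simps)
  thus ?thesis using sv_base_mult by (simp flip: mult.assoc)
qed

lemma inverse_array_base: "fps_const (1 - indet_x) / inverse_denom = sv_base * fps_exp (- 1)"
proof -
  have "sv_base * fps_exp (- 1) * inverse_denom =
      fps_const (1 - indet_x) * (fps_exp 1 * fps_exp (- 1))"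
    using sv_base_mult_inverse_denom by (simp add: mult_ac)
  also have "\<dots> = fps_const (1 - indet_x)"
    by (simp flip: fps_exp_add_mult)
  finally show ?thesis
    using inverse_denom_nth_0
    by (metis fps_divide_times_eq fps_nonzero_nth nonzero_mult_div_cancel_right)
qed

lemma inverse_array_inner: "(fps_exp 1 - fps_exp indet_x) / inverse_denom = sv_base - 1"
proof -
  have "(sv_base - 1) * inverse_denom = fps_exp 1 - fps_exp indet_x"
    unfolding left_diff_distrib sv_base_mult_inverse_denom
    by (simp add: algebra_simps flip: fps_const_sub)
  thus ?thesis
    using inverse_denom_nth_0
    by (metis fps_nonzero_nth nonzero_mult_div_cancel_right)
qed

lemma sv_weight_compose:
  "sv_weight oo (sv_base - 1) =
    (fps_const (1 - indet_x) + fps_const indet_x * sv_base) * fps_powr sv_base indet_y"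
  using sv_base_nth_0
  by (simp add: fps_compose_mult_distrib fps_compose_add_distrib fps_powr_compose)
    (simp add: algebra_simps flip: fps_const_sub)

lemma sv_rate_compose: "sv_rate oo (sv_base - 1) = fps_deriv (sv_base - 1)"
  using sv_base_nth_0
  by (simp add: fps_compose_mult_distrib fps_compose_add_distrib sv_base_deriv algebra_simps
      flip: fps_const_sub)

text \<open>The chain rule with \<open>\<phi>' = R(\<phi>)\<close>: a derivative after the
  substitution becomes \<open>R h'\<close> before it.\<close>

lemma fps_deriv_compose_sv_base:
  "fps_deriv (h oo (sv_base - 1)) = (fps_deriv h * sv_rate) oo (sv_base - 1)"
proof -
  have \<phi>0: "fps_nth (sv_base - 1) 0 = 0" by (simp add: sv_base_nth_0)
  show ?thesis
    unfolding fps_compose_deriv[OF \<phi>0] sv_rate_compose[symmetric]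
    by (simp only: fps_compose_mult_distrib[OF \<phi>0])
qed

text \<open>Both sides have constant term 1 and the same logarithmic derivative \<open>r\<close>,
  with \<open>a = B' / B\<close>.\<close>

lemma inverse_array_outer:
  "fps_exp (indet_x + indet_y) * fps_powr (fps_const (1 - indet_x) / inverse_denom) (indet_y + 1) =
    sv_weight oo (sv_base - 1)"
proof -
  define a where "a = fps_const (1 - indet_x) + fps_const indet_x * sv_base"
  define W where "W = sv_base * fps_exp (- 1)"
  \<comment> \<open>Read off the left side: \<open>x + y\<close> from the exponential,
    \<open>(y + 1) (a - 1)\<close> from the power.\<close>
  define r where "r = fps_const (indet_x + indet_y) + fps_const (indet_y + 1) * (a - 1)"
  have a0: "fps_nth a 0 = 1" and W0: "fps_nth W 0 = 1"
    by (simp_all add: a_def W_def sv_base_nth_0)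
  have B': "fps_deriv sv_base = sv_base * a"
    by (simp add: sv_base_deriv a_def mult.commute)
  have logB: "fps_deriv (fps_log sv_base) = a"
    by (rule fps_deriv_log_eqI) (simp_all add: sv_base_nth_0 B')
  have logW: "fps_deriv (fps_log W) = a - 1"
  proof (rule fps_deriv_log_eqI)
    show "fps_deriv W = W * (a - 1)"
      by (simp add: W_def B' algebra_simps flip: fps_const_neg)
  qed (rule W0)
  \<comment> \<open>The form read off the right side: \<open>a' / a = x B\<close> and
    \<open>y B' / B = y a\<close>. The two agree because \<open>a - 1 = x (B - 1)\<close>.\<close>
  have r: "r = fps_const indet_x * sv_base + fps_const indet_y * a"
    by (simp add: r_def a_def algebra_simps flip: fps_const_sub fps_const_add)
  have "fps_exp (indet_x + indet_y) * fps_powr W (indet_y + 1) = a * fps_powr sv_base indet_y"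
  proof (rule fps_eqI_log_deriv)
    show "fps_deriv (fps_exp (indet_x + indet_y) * fps_powr W (indet_y + 1)) =
        fps_exp (indet_x + indet_y) * fps_powr W (indet_y + 1) * r"
      by (simp add: fps_deriv_powr logW r_def algebra_simps)
    have "fps_deriv a = fps_const indet_x * (sv_base * a)"
      by (simp add: a_def B')
    thus "fps_deriv (a * fps_powr sv_base indet_y) = a * fps_powr sv_base indet_y * r"
      by (simp add: fps_deriv_powr logB r algebra_simps)
  qed (simp_all add: a0)
  thus ?thesis
    by (simp only: inverse_array_base sv_weight_compose flip: a_def W_def)
qed

section \<open>The compositional inverse of the inner series\<close>

lemma array_inner_deriv:
  "sv_rate * fps_deriv (fps_const (1 / (1 - indet_x)) *
      fps_log ((1 + fps_X) / (1 + fps_const indet_x * fps_X))) = 1"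
proof -
  define V where "V = 1 + fps_const indet_x * fps_X"
  define u where "u = (1 + fps_X) / V"
  define i where "i = inverse (V * (1 + fps_X))"
  have V0: "fps_nth V 0 = 1" and V: "V \<noteq> 0"
    by (auto simp: V_def dest!: arg_cong[of _ _ "\<lambda>u. fps_nth u 0"])
  have uV: "u * V = 1 + fps_X"
    using V0 by (simp add: u_def fps_divide_unit mult.assoc inverse_mult_eq_1)
  have u0: "fps_nth u 0 = 1"
    using arg_cong[OF uV, of "\<lambda>u. fps_nth u 0"] V0 by simp
  have i: "i * (V * (1 + fps_X)) = 1"
    using V0 by (simp add: i_def inverse_mult_eq_1)
  \<comment> \<open>Quotient rule without division: differentiate \<open>u * V = 1 + fps_X\<close>.
    Clearing \<open>V\<close> twice gives \<open>u' / u = (1 - x) / R\<close>, where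
    \<open>i\<close> is \<open>1 / R\<close>.\<close>
  have "fps_deriv (u * V) = 1"
    by (simp add: uV)
  hence u': "fps_deriv u * V = 1 - u * fps_const indet_x"
    by (simp add: V_def algebra_simps)
  have "fps_deriv u * V * V = V - u * V * fps_const indet_x"
    unfolding u' by (simp add: algebra_simps)
  also have "\<dots> = fps_const (1 - indet_x)"
    unfolding uV by (simp add: V_def algebra_simps flip: fps_const_sub)
  also have "\<dots> = fps_const (1 - indet_x) * (i * (V * (u * V)))"
    unfolding uV i by simp
  also have "\<dots> = u * (fps_const (1 - indet_x) * i) * V * V"
    by (simp add: mult_ac)
  finally have "fps_deriv (fps_log u) = fps_const (1 - indet_x) * i"
    using V u0 by (intro fps_deriv_log_eqI) simp_all
  hence "sv_rate * fps_deriv (fps_const (1 / (1 - indet_x)) * fps_log u) =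
      fps_const (1 / (1 - indet_x)) * fps_const (1 - indet_x) * (i * (V * (1 + fps_X)))"
    by (simp add: V_def mult_ac)
  also have "\<dots> = 1"
    unfolding i using indet_x_neq_1 by simp
  finally show ?thesis by (simp add: u_def V_def)
qed

text \<open>The composite has derivative \<open>(R f')(\<phi>) = 1\<close> and constant term
  0.\<close>

lemma array_inner_compose:
  "(fps_const (1 / (1 - indet_x)) * fps_log ((1 + fps_X) / (1 + fps_const indet_x * fps_X)))
     oo (sv_base - 1) = fps_X"
  (is "?f oo ?\<phi> = _")
proof -
  have "fps_deriv (?f oo ?\<phi>) = (sv_rate * fps_deriv ?f) oo ?\<phi>"
    unfolding fps_deriv_compose_sv_base by (simp only: mult.commute)
  also have "\<dots> = fps_deriv fps_X"
    by (simp only: array_inner_deriv) simp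
  finally have "?f oo ?\<phi> = fps_const (fps_nth (?f oo ?\<phi>) 0 - fps_nth fps_X 0) + fps_X"
    by (simp only: fps_deriv_eq_iff)
  thus ?thesis by simp
qed

section \<open>Higher derivatives of the moment series\<close>

lemma sv_weight_deriv:
  "fps_deriv sv_weight * sv_rate =
    fps_of_poly [:indet_x + indet_y, indet_x + indet_x * indet_y:] * sv_weight"
proof -
  define p where "p = fps_powr (1 + fps_X) indet_y"
  define p' where "p' = fps_deriv p"
  have p': "(1 + fps_X) * p' = fps_const indet_y * p"
    by (simp add: p'_def p_def fps_deriv_powr_one_plus_X)
  \<comment> \<open>Here \<open>S' / S = x / (1 + x u) + y / (1 + u)\<close>, and \<open>R\<close>
    clears both denominators.\<close>
  have "fps_deriv sv_weight * sv_rate = (1 + fps_const indet_x * fps_X) *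
      (fps_const indet_x * (1 + fps_X) * p + (1 + fps_const indet_x * fps_X) * ((1 + fps_X) * p'))"
    by (simp add: p'_def p_def algebra_simps)
  also have "\<dots> = (fps_const indet_x * (1 + fps_X) + fps_const indet_y * (1 + fps_const indet_x * fps_X)) *
      sv_weight"
    unfolding p' by (simp add: p_def algebra_simps flip: fps_const_mult)
  also have "fps_const indet_x * (1 + fps_X) + fps_const indet_y * (1 + fps_const indet_x * fps_X) =
      fps_of_poly [:indet_x + indet_y, indet_x + indet_x * indet_y:]"
    by (simp add: fps_of_poly_pCons algebra_simps flip: fps_const_add fps_const_mult)
  finally show ?thesis .
qed

lemma sv_rate_of_poly: "sv_rate = fps_of_poly [:1, 1 + indet_x, indet_x:]"
  by (simp add: fps_of_poly_pCons algebra_simps flip: fps_const_add)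

text \<open>As \<open>R S'\<close> is a linear polynomial times \<open>S\<close>, each
  differentiation leaves a factor \<open>S\<close>; the cofactors obey the recursion of
  \<open>moment_poly\<close>.\<close>

lemma higher_deriv_sv_weight_compose:
  "(fps_deriv ^^ k) (sv_weight oo (sv_base - 1)) =
    (sv_weight * fps_of_poly (moment_poly k)) oo (sv_base - 1)"
proof (induction k)
  case (Suc k)
  define q where "q = moment_poly k"
  define s where "s = sv_weight"
  have "(fps_deriv ^^ Suc k) (s oo (sv_base - 1)) =
      fps_deriv ((s * fps_of_poly q) oo (sv_base - 1))"
    using Suc by (simp add: s_def q_def)
  also have "\<dots> = (fps_deriv (s * fps_of_poly q) * sv_rate) oo (sv_base - 1)"
    by (rule fps_deriv_compose_sv_base)
  also have "fps_deriv (s * fps_of_poly q) * sv_rate =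
      s * (sv_rate * fps_of_poly (pderiv q)) + fps_deriv s * sv_rate * fps_of_poly q"
    by (simp add: fps_of_poly_pderiv algebra_simps)
  also have "\<dots> = s * fps_of_poly (moment_poly (Suc k))"
    unfolding s_def sv_weight_deriv unfolding sv_rate_of_poly
    by (simp only: moment_poly.simps fps_of_poly_add fps_of_poly_mult q_def distrib_left mult_ac)
  finally show ?case by (simp only: s_def)
qed simp

text \<open>The index shift is a derivative: that of \<open>B^y\<close> is
  \<open>y S(\<phi>)\<close>, and the factor \<open>y\<close> cancels.\<close>

lemma sv_moment_egf:
  "savage_viswanathan (n + 1) / indet_y = fact n * fps_nth (sv_weight oo (sv_base - 1)) n"
proof -
  have "savage_viswanathan (n + 1) = fact n * fps_nth (fps_deriv (fps_powr sv_base indet_y)) n"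
    by (simp add: savage_viswanathan_def mult_ac)
  also have "fps_deriv (fps_powr sv_base indet_y) =
      fps_const indet_y * (sv_weight oo (sv_base - 1))"
    unfolding sv_deriv sv_weight_compose by (simp only: distrib_right mult.assoc)
  finally show ?thesis
    using indet_y_neq_0 by (simp only: fps_mult_left_const_nth) simp
qed

theorem proposition13:
  fixes M N :: "nat \<Rightarrow> nat \<Rightarrow> ratfun"
  assumes M_def: "M = exp_riordan
      (1 / ((1 + fps_const indet_x * fps_X) * fps_powr (1 + fps_X) indet_y))
      (fps_const (1 / (1 - indet_x)) * fps_log ((1 + fps_X) / (1 + fps_const indet_x * fps_X)))"
    and N_def: "N = exp_riordan
      (fps_exp (indet_x + indet_y) *
        fps_powr (fps_const (1 - indet_x) / (fps_exp indet_x - fps_const indet_x * fps_exp 1))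
          (indet_y + 1))
      ((fps_exp 1 - fps_exp indet_x) / (fps_exp indet_x - fps_const indet_x * fps_exp 1))"
  shows "(\<exists>p. coefficient_array M p \<and>
            orthogonal_with_moments p (\<lambda>n. savage_viswanathan (n + 1) / indet_y)) \<and>
         lt_inverse M N \<and>
         (\<forall>n. N n 0 = savage_viswanathan (n + 1) / indet_y)"
proof -
  define f where "f = fps_const (1 / (1 - indet_x)) *
      fps_log ((1 + fps_X) / (1 + fps_const indet_x * fps_X))"
  define s where "s = sv_weight"
  define \<phi> where "\<phi> = sv_base - 1"
  define \<mu> where "\<mu> = (\<lambda>n. savage_viswanathan (n + 1) / indet_y)"
  have M: "M = exp_riordan (1 / s) f"
    by (simp only: M_def f_def s_def)
  have N: "N = exp_riordan (s oo \<phi>) \<phi>"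
    by (simp only: N_def inverse_array_outer inverse_array_inner s_def \<phi>_def)
  have pair: "exp_riordan_pair (1 / s) f"
    using exp_riordan_pair_array by (simp only: f_def s_def)
  have pair': "exp_riordan_pair (s oo \<phi>) \<phi>"
    using exp_riordan_pair_inverse_array
    by (simp only: inverse_array_outer inverse_array_inner s_def \<phi>_def)
  have f0: "fps_nth f 0 = 0" and \<phi>0: "fps_nth \<phi> 0 = 0" and \<phi>1: "fps_nth \<phi> 1 \<noteq> 0"
    using pair pair' by (simp_all add: exp_riordan_pair_def)
  have s0: "fps_nth s 0 = 1"
    by (simp add: s_def)
  hence inv: "1 / s * s = 1"
    by (simp add: fps_divide_unit inverse_mult_eq_1)
  have f\<phi>: "f oo \<phi> = fps_X"
    unfolding f_def \<phi>_def by (rule array_inner_compose)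
  hence \<phi>f: "\<phi> oo f = fps_X"
    by (rule fps_compose_X_swap[OF f0 \<phi>0 \<phi>1])
  \<comment> \<open>The constant coefficient of \<open>R f' = 1\<close>; together with
    \<open>s0\<close> it makes the row polynomials monic.\<close>
  have f1: "fps_nth f 1 = 1"
  proof -
    have "fps_nth (sv_rate * fps_deriv f) 0 = 1"
      unfolding f_def array_inner_deriv by simp
    thus ?thesis by simp
  qed
  \<comment> \<open>Substituting \<open>f\<close> undoes \<open>\<phi>\<close> and
    \<open>1 / s\<close> cancels the weight, so only \<open>moment_poly k\<close> remains.\<close>
  have moment: "moment_functional \<mu> (monom 1 k * row_poly M n) = fact n * coeff (moment_poly k) n"
    for k n
  proof -
    have "((s * fps_of_poly (moment_poly k)) oo \<phi>) oo f = s * fps_of_poly (moment_poly k)"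
      using \<phi>f by (simp add: fps_compose_assoc[OF f0 \<phi>0, symmetric])
    moreover have "moment_functional \<mu> (monom 1 k * row_poly M n) =
        fact n * fps_nth (1 / s * ((fps_deriv ^^ k) (s oo \<phi>) oo f)) n"
      unfolding M
      by (rule moment_functional_exp_riordan[OF f0]) (simp only: \<mu>_def s_def \<phi>_def sv_moment_egf)
    ultimately have "moment_functional \<mu> (monom 1 k * row_poly M n) =
        fact n * fps_nth (1 / s * (s * fps_of_poly (moment_poly k))) n"
      by (simp only: s_def \<phi>_def higher_deriv_sv_weight_compose)
    thus ?thesis by (simp only: inv mult_1 fps_of_poly_nth flip: mult.assoc)
  qed
  have "orthogonal_with_moments (row_poly M) \<mu>"
  proof (rule orthogonal_row_polyI)
    show "M n n = 1" for n
      using s0 by (simp add: M exp_riordan_diagonal[OF f0] f1[unfolded One_nat_def] fps_divide_unit)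
  qed (simp_all add: moment coeff_moment_poly_above coeff_moment_poly_diag)
  moreover have "coefficient_array M (row_poly M)"
    using lower_triangular_exp_riordan[OF pair] by (simp add: coefficient_array_def row_poly_def M)
  moreover have "lt_inverse M N"
    unfolding M N by (rule lt_inverse_exp_riordan[OF pair pair' f\<phi> inv])
  \<comment> \<open>Column 0 contains no power of the inner series, so its generating function is
    the outer series \<open>G\<close>.\<close>
  moreover have "N n 0 = \<mu> n" for n
    unfolding \<mu>_def sv_moment_egf by (simp add: N exp_riordan_def s_def \<phi>_def)
  ultimately show ?thesis unfolding \<mu>_def by blast
qed

end
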